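(* For $k=0,1,2,\dots$ let $a_k=2^{-k}$, $E_k=E(a_k)$ and $O_k=O(a_k)$, where $E(a),O(a)\subset\mathbb{R}^3$ are the explicit tetrahedra defined in the context. The sequence $$E_0\longrightarrow O_0\longrightarrow E_1\longrightarrow O_1\longrightarrow E_2\longrightarrow\cdots$$ is an admissible longest-edge bisection sequence, and the family $\{E_k,O_k: k\ge 0\}$ of its members violates shape regularity, the tetrahedral minimum-angle condition, and the tetrahedral maximum-angle condition. More precisely, for every $k\ge 0$, $$\frac{|E_k|}{h_{E_k}^3}=\frac{\sqrt7}{12}\,\frac{\sqrt{a_k}}{(2+a_k)^{3/2}},\qquad \delta(a_k)=\arctan\sqrt{\frac{8a_k}{7}},\qquad \cos\Theta(a_k)=\frac{2a_k-7}{\sqrt{(4a_k+7)(8a_k+7)}},$$ and, as $k\to\infty$, $$\frac{|E_k|}{h_{E_k}^3}\to 0,\qquad \delta(a_k)\to 0,\qquad \cos\Theta(a_k)\to-1,$$ so that $\Theta(a_k)\to\pi$. Here $\delta(a)$ is the interior dihedral angle of $E(a)$ at the edge $CD$, and $\Theta(a)$ is the interior dihedral angle of $O(a)$ at the edge $MC$.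
   Context: For $0<a\le 1$ let $E(a)=\operatorname{conv}\{A,B,C,D\}\subset\mathbb{R}^3$, where $$A=(0,0,a),\quad B=(0,0,0),\quad C=(\sqrt a,0,0),\quad D=\left(\frac{\sqrt a}{2},\frac{\sqrt{7a}}{2},0\right).$$ Let $M=\frac{A+D}{2}$ and $O(a)=\operatorname{conv}\{M,B,D,C\}$. Longest-edge bisection: given a (nondegenerate) tetrahedron $T=\operatorname{conv}\{P,Q,R,S\}$ and an edge $PQ$ whose length is maximal among the six edges of $T$ (if several edges are tied for longest, any one of them may be chosen), let $X=(P+Q)/2$; the two children of $T$ are $\operatorname{conv}\{P,X,R,S\}$ and $\operatorname{conv}\{X,Q,R,S\}$. A sequence of tetrahedra is an admissible longest-edge bisection sequence if each member after the first is congruent (isometric) to one of the two children obtained from its predecessor by bisecting some longest edge of that predecessor. For a tetrahedron $T$, $|T|$ denotes its volume and $h_T=\operatorname{diam} T$ its diameter. A family of tetrahedra is shape regular if there is a constant $c>0$ with $|T|\ge c\,h_T^3$ for all $T$ in the family. It satisfies the minimum-angle condition if there is a positive constant bounding from below all face angles (angles of the triangular faces) and all interior dihedral angles of all members. It satisfies the maximum-angle condition if there is a constant smaller than $\pi$ bounding from above all face angles and all interior dihedral angles of all members. "Violates" means the family does not satisfy the condition. The interior dihedral angle of a tetrahedron at an edge $PQ$ with remaining vertices $R,S$ is the angle in $(0,\pi)$ between the orthogonal projections of $R-P$ and $S-P$ onto the plane perpendicular to $Q-P$. *)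

theory Defs
  imports "HOL-Analysis.Analysis"
begin

definition tetrahedron_on :: "real^3 \<Rightarrow> real^3 \<Rightarrow> real^3 \<Rightarrow> real^3 \<Rightarrow> (real^3) set \<Rightarrow> bool" where
  "tetrahedron_on P Q R S T \<longleftrightarrow>
     distinct [P, Q, R, S] \<and> \<not> affine_dependent {P, Q, R, S} \<and> T = convex hull {P, Q, R, S}"

definition tetrahedron :: "(real^3) set \<Rightarrow> bool" where
  "tetrahedron T \<longleftrightarrow> (\<exists>P Q R S. tetrahedron_on P Q R S T)"

definition longest_edge :: "real^3 \<Rightarrow> real^3 \<Rightarrow> real^3 \<Rightarrow> real^3 \<Rightarrow> bool" where
  "longest_edge P Q R S \<longleftrightarrow>
     (\<forall>d \<in> {dist P Q, dist P R, dist P S, dist Q R, dist Q S, dist R S}. d \<le> dist P Q)"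

text \<open>Since all labellings \<open>P, Q, R, S\<close> of the vertices are considered, the set contains the
  two children for every choice of a longest edge \<open>PQ\<close>.\<close>

definition bisection_children :: "(real^3) set \<Rightarrow> (real^3) set set" where
  "bisection_children T =
     {T'. \<exists>P Q R S. tetrahedron_on P Q R S T \<and> longest_edge P Q R S \<and>
            (T' = convex hull {P, midpoint P Q, R, S} \<or>
             T' = convex hull {midpoint P Q, Q, R, S})}"

definition congruent_sets :: "(real^3) set \<Rightarrow> (real^3) set \<Rightarrow> bool" where
  "congruent_sets T T' \<longleftrightarrow> (\<exists>f. (\<forall>x y. dist (f x) (f y) = dist x y) \<and> f ` T = T')"

definition admissible_bisection_sequence :: "(nat \<Rightarrow> (real^3) set) \<Rightarrow> bool" where
  "admissible_bisection_sequence \<T> \<longleftrightarrow>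
     (\<forall>n. tetrahedron (\<T> n)) \<and>
     (\<forall>n. \<exists>T' \<in> bisection_children (\<T> n). congruent_sets (\<T> (Suc n)) T')"

definition vector_angle :: "real^3 \<Rightarrow> real^3 \<Rightarrow> real" where
  "vector_angle u v = arccos (u \<bullet> v / (norm u * norm v))"

text \<open>Orthogonal projection of \<open>v\<close> onto the plane perpendicular to \<open>u\<close>; only meaningful for \<open>u \<noteq> 0\<close>.\<close>

definition perp_proj :: "real^3 \<Rightarrow> real^3 \<Rightarrow> real^3" where
  "perp_proj u v = v - ((v \<bullet> u) / (u \<bullet> u)) *\<^sub>R u"

text \<open>Argument order: the edge is \<open>PQ\<close>, the remaining vertices are \<open>R\<close> and \<open>S\<close>.\<close>

definition dihedral_angle :: "real^3 \<Rightarrow> real^3 \<Rightarrow> real^3 \<Rightarrow> real^3 \<Rightarrow> real" where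
  "dihedral_angle P Q R S =
     vector_angle (perp_proj (Q - P) (R - P)) (perp_proj (Q - P) (S - P))"

text \<open>As \<open>P, Q, R, S\<close> range over all labellings of the vertices, the angle at \<open>P\<close> in the face \<open>PQR\<close>
  runs through all twelve face angles, and the dihedral angle at \<open>PQ\<close> through all six.\<close>

definition face_angles :: "(real^3) set \<Rightarrow> real set" where
  "face_angles T = {vector_angle (Q - P) (R - P) |P Q R S. tetrahedron_on P Q R S T}"

definition dihedral_angles :: "(real^3) set \<Rightarrow> real set" where
  "dihedral_angles T = {dihedral_angle P Q R S |P Q R S. tetrahedron_on P Q R S T}"

definition shape_regular :: "(real^3) set set \<Rightarrow> bool" where
  "shape_regular \<F> \<longleftrightarrow> (\<exists>c>0. \<forall>T\<in>\<F>. measure lebesgue T \<ge> c * diameter T ^ 3)"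

definition minimum_angle_condition :: "(real^3) set set \<Rightarrow> bool" where
  "minimum_angle_condition \<F> \<longleftrightarrow>
     (\<exists>c>0. \<forall>T\<in>\<F>. \<forall>\<alpha> \<in> face_angles T \<union> dihedral_angles T. c \<le> \<alpha>)"

definition maximum_angle_condition :: "(real^3) set set \<Rightarrow> bool" where
  "maximum_angle_condition \<F> \<longleftrightarrow>
     (\<exists>c<pi. \<forall>T\<in>\<F>. \<forall>\<alpha> \<in> face_angles T \<union> dihedral_angles T. \<alpha> \<le> c)"

definition pt_A :: "real \<Rightarrow> real^3" where "pt_A a = vector [0, 0, a]"
definition pt_B :: "real^3" where "pt_B = vector [0, 0, 0]"
definition pt_C :: "real \<Rightarrow> real^3" where "pt_C a = vector [sqrt a, 0, 0]"
definition pt_D :: "real \<Rightarrow> real^3" where "pt_D a = vector [sqrt a / 2, sqrt (7 * a) / 2, 0]"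
definition pt_M :: "real \<Rightarrow> real^3" where "pt_M a = midpoint (pt_A a) (pt_D a)"

definition tet_E :: "real \<Rightarrow> (real^3) set" where
  "tet_E a = convex hull {pt_A a, pt_B, pt_C a, pt_D a}"

definition tet_O :: "real \<Rightarrow> (real^3) set" where
  "tet_O a = convex hull {pt_M a, pt_B, pt_D a, pt_C a}"

definition delta :: "real \<Rightarrow> real" where
  "delta a = dihedral_angle (pt_C a) (pt_D a) (pt_A a) pt_B"

definition Theta :: "real \<Rightarrow> real" where
  "Theta a = dihedral_angle (pt_M a) (pt_C a) pt_B (pt_D a)"

end

theory Submission
  imports Defs
begin

text \<open>
  The tetrahedron \<open>E(a)\<close> has the unique longest edge \<open>AD\<close>, and the child containing \<open>D\<close> is \<open>O(a)\<close>.
  In \<open>O(a)\<close> the edge \<open>BD\<close> is longest; with \<open>N\<close> its midpoint, the segment \<open>MN\<close> is vertical of length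
  \<open>a/2\<close>, and \<open>M, N, B, C\<close> play the roles of \<open>A, B, C, D\<close> in a congruent copy of \<open>E(a/2)\<close>.
  So halving \<open>a\<close> takes two bisections, while the height shrinks like \<open>a\<close> and the base only like
  \<open>sqrt a\<close>: the flattening shows in the volume ratio, in the dihedral angle at \<open>CD\<close> and in the one
  at \<open>MC\<close>.
\<close>

section \<open>Nondegeneracy, volume and diameter of a general tetrahedron\<close>

lemma tetrahedron_on_convex_hull:
  fixes P Q R S :: "real^3"
  assumes D: "(Q - P) \<bullet> cross3 (R - P) (S - P) \<noteq> 0"
  shows "tetrahedron_on P Q R S (convex hull {P, Q, R, S})"
proof -
  have dist: "distinct [P, Q, R, S]"
    using D by (auto simp: cross_eq_0 dot_cross_self cross_refl)
  have "\<not> affine_dependent {P, Q, R, S}"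
  proof
    assume "affine_dependent {P, Q, R, S}"
    then obtain U where U: "sum U {P, Q, R, S} = 0" "\<exists>v\<in>{P, Q, R, S}. U v \<noteq> 0"
        "(\<Sum>v\<in>{P, Q, R, S}. U v *\<^sub>R v) = 0"
      by (subst (asm) affine_dependent_explicit_finite) auto
    define x y z where xyz: "x = Q - P" "y = R - P" "z = S - P"
    have UP: "U P = - (U Q + U R + U S)"
      using U(1) dist by (simp add: add_eq_0_iff algebra_simps)
    have eq: "U Q *\<^sub>R x + U R *\<^sub>R y + U S *\<^sub>R z = 0"
      using U(3) dist by (simp add: UP xyz algebra_simps)
    have D': "x \<bullet> cross3 y z \<noteq> 0"
      using D by (simp add: xyz)
    \<comment> \<open>Pairing the linear relation with the cross product of two edge vectors kills
      both of them and leaves the third coefficient times the nonzero triple product.\<close>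
    have "U Q * (x \<bullet> cross3 y z) = 0"
      using arg_cong[OF eq, of "\<lambda>v. v \<bullet> cross3 y z"]
      by (simp add: inner_add_left dot_cross_self)
    moreover have "U R * (x \<bullet> cross3 y z) = 0"
      using arg_cong[OF eq, of "\<lambda>v. v \<bullet> cross3 z x"] cross_triple[of x y z] cross_triple[of z x y]
        inner_commute[of x] inner_commute[of y]
      by (simp add: inner_add_left dot_cross_self)
    moreover have "U S * (x \<bullet> cross3 y z) = 0"
      using arg_cong[OF eq, of "\<lambda>v. v \<bullet> cross3 x y"] cross_triple[of x y z]
        inner_commute[of x] inner_commute[of z]
      by (simp add: inner_add_left dot_cross_self)
    ultimately have "U Q = 0" "U R = 0" "U S = 0"
      using D' by auto
    with UP U(2) show False by auto
  qed
  with dist show ?thesis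
    by (simp add: tetrahedron_on_def)
qed

lemma measure_tetrahedron:
  fixes P Q R S :: "real^3"
  assumes "distinct [P, Q, R, S]"
  shows "measure lebesgue (convex hull {P, Q, R, S}) = \<bar>(Q - P) \<bullet> cross3 (R - P) (S - P)\<bar> / 6"
proof -
  \<comment> \<open>\<open>content_simplex\<close> wants the vertices other than \<open>P\<close>
    enumerated by the index type. The edge vectors then become the columns of a matrix whose
    determinant is the triple product.\<close>
  define f :: "3 \<Rightarrow> real^3" where "f = (\<lambda>j. if j = 1 then Q else if j = 2 then R else S)"
  have U: "(UNIV :: 3 set) = {1, 2, 3}"
    using exhaust_3 by auto
  have bij: "bij_betw f UNIV ({P, Q, R, S} - {P})"
    using assms unfolding U by (auto simp: bij_betw_def inj_on_def f_def)
  have "compact (convex hull {P, Q, R, S})"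
    by (intro finite_imp_compact_convex_hull) auto
  then have "convex hull {P, Q, R, S} \<in> sets borel"
    by (simp add: borel_compact)
  then have "measure lebesgue (convex hull {P, Q, R, S}) = measure lborel (convex hull {P, Q, R, S})"
    by (simp add: measure_completion)
  also have "\<dots> = \<bar>det (\<chi> i. \<chi> j. f j $ i - P $ i)\<bar> / fact CARD(3)"
    by (rule content_simplex[OF _ _ _ bij]) (use assms in auto)
  also have "det (\<chi> i. \<chi> j. f j $ i - P $ i) = (Q - P) \<bullet> cross3 (R - P) (S - P)"
    by (simp add: cross3_simps f_def)
  finally show ?thesis
    by (simp add: fact_numeral)
qed

text \<open>Any two points of the hull are at most as far apart as some two generators, so a
  farthest pair of generators realises the diameter.\<close>

lemma diameter_convex_hull_eq_dist:
  fixes S :: "'a::euclidean_space set"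
  assumes "finite S" "u \<in> S" "v \<in> S" "\<And>x y. x \<in> S \<Longrightarrow> y \<in> S \<Longrightarrow> dist x y \<le> dist u v"
  shows "diameter (convex hull S) = dist u v"
proof (rule antisym)
  show "diameter (convex hull S) \<le> dist u v"
  proof (rule diameter_le)
    show "convex hull S \<noteq> {} \<or> 0 \<le> dist u v" by simp
  next
    fix x y assume "x \<in> convex hull S" "y \<in> convex hull S"
    then show "norm (x - y) \<le> dist u v"
      using simplex_extremal_le_exists[OF assms(1), of x y] assms(4)
      by (force simp: dist_norm)
  qed
  have "bounded (convex hull S)"
    using assms(1) by (simp add: bounded_convex_hull finite_imp_bounded)
  then show "dist u v \<le> diameter (convex hull S)"
    by (rule diameter_bounded_bound) (use assms in \<open>auto intro: hull_inc\<close>)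
qed

section \<open>Angles and coordinates through inner products\<close>

lemma inner_perp_proj:
  assumes "u \<noteq> 0"
  shows "perp_proj u v \<bullet> perp_proj u w = v \<bullet> w - (v \<bullet> u) * (w \<bullet> u) / (u \<bullet> u)"
  using assms
  by (simp add: perp_proj_def inner_diff_left inner_diff_right inner_commute)

text \<open>Cauchy-Schwarz keeps the quotient in the domain of \<open>arccos\<close>; for a zero
  vector, division by zero makes it 0, which lies there too.\<close>

lemma cos_vector_angle: "cos (vector_angle u v) = u \<bullet> v / (norm u * norm v)"
proof -
  have "\<bar>u \<bullet> v / (norm u * norm v)\<bar> \<le> 1"
    using Cauchy_Schwarz_ineq2[of u v]
    by (cases "u = 0 \<or> v = 0") (auto simp: abs_mult)
  then show ?thesis
    by (simp add: vector_angle_def cos_arccos_abs)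
qed

lemma midpoint_component: "midpoint x y $ i = (x $ i + y $ i) / 2" for x y :: "real^'n"
  by (simp add: midpoint_def)

lemma dist_le_iff_inner: "dist x y \<le> dist z w \<longleftrightarrow> (x - y) \<bullet> (x - y) \<le> (z - w) \<bullet> (z - w)"
  for x y z w :: "'a::real_inner"
  by (simp add: dist_norm norm_le)

text \<open>With \<open>a = s * s\<close> the coordinates become polynomials in \<open>s\<close>
  whose only irrational coefficient is \<open>sqrt 7\<close>, so lengths and determinants reduce to
  polynomial arithmetic.\<close>

lemma pt_coordinates:
  assumes "s > 0"
  shows "pt_A (s * s) = vector [0, 0, s * s]" "pt_B = vector [0, 0, 0]" "pt_C (s * s) = vector [s, 0, 0]"
    "pt_D (s * s) = vector [s / 2, sqrt 7 * s / 2, 0]"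
    "pt_M (s * s) = vector [s / 4, sqrt 7 * s / 4, s * s / 2]"
  using assms
  by (auto simp: pt_A_def pt_B_def pt_C_def pt_D_def pt_M_def real_sqrt_mult vec_eq_iff forall_3 midpoint_component)

lemma pos_square:
  assumes "a > 0"
  obtains s :: real where "s > 0" "a = s * s"
  using assms real_sqrt_mult_self[of a] real_sqrt_gt_zero[of a] by (metis abs_of_pos)

lemma sqrt_numeral_mult_self:
  "sqrt (numeral n) * sqrt (numeral n) = (numeral n :: real)"
  "sqrt (numeral n) * (sqrt (numeral n) * x) = numeral n * x"
  by (simp_all flip: mult.assoc)

section \<open>Nondegeneracy and longest edges of E(a) and O(a)\<close>

lemma tetrahedron_on_tet_E:
  assumes "a > 0"
  shows "tetrahedron_on (pt_A a) pt_B (pt_C a) (pt_D a) (tet_E a)"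
proof -
  obtain s where s: "s > 0" "a = s * s"
    using assms(1) by (rule pos_square)
  show ?thesis unfolding tet_E_def
    by (rule tetrahedron_on_convex_hull) (use s in \<open>simp add: pt_coordinates cross3_simps\<close>)
qed

lemma tetrahedron_on_tet_O:
  assumes "a > 0"
  shows "tetrahedron_on (pt_M a) pt_B (pt_D a) (pt_C a) (tet_O a)"
proof -
  obtain s where s: "s > 0" "a = s * s"
    using assms(1) by (rule pos_square)
  show ?thesis unfolding tet_O_def
    by (rule tetrahedron_on_convex_hull) (use s in \<open>simp add: pt_coordinates cross3_simps\<close>)
qed

lemma tetrahedron_on_permute:
  assumes "tetrahedron_on P Q R S T" "{P', Q', R', S'} = {P, Q, R, S}"
  shows "tetrahedron_on P' Q' R' S' T"
proof -
  have "card {P', Q', R', S'} = 4"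
    using assms by (simp add: tetrahedron_on_def)
  then have "distinct [P', Q', R', S']"
    by (intro card_distinct) simp
  with assms show ?thesis
    by (simp add: tetrahedron_on_def)
qed

text \<open>The squared length of AD is a^2 + 2a; the others are a^2 (AB), a^2 + a (AC), a (BC) and
  2a (BD and CD).\<close>

lemma longest_edge_tet_E:
  assumes "a > 0"
  shows "longest_edge (pt_A a) (pt_D a) pt_B (pt_C a)"
proof -
  obtain s where s: "s > 0" "a = s * s"
    using assms(1) by (rule pos_square)
  then show ?thesis
    by (simp add: longest_edge_def dist_le_iff_inner pt_coordinates inner_vec_def sum_3 sqrt_numeral_mult_self algebra_simps power2_eq_square)
qed

text \<open>BD ties with CD at squared length 2a, and the sequence bisects BD. The squared lengths
  of BC and MC are a and a + a^2/4.\<close>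

lemma longest_edge_tet_O:
  assumes "a > 0" "a \<le> 1"
  shows "longest_edge pt_B (pt_D a) (pt_M a) (pt_C a)"
proof -
  obtain s where s: "s > 0" "a = s * s"
    using assms(1) by (rule pos_square)
  have "(s * s) * (s * s) \<le> (s * s) * 1"
    using assms s by (intro mult_left_mono) auto
  moreover have "0 \<le> s * s" by simp
  \<comment> \<open>This is the comparison for MB and MD, whose common squared length is a/2 +
    a^2/4.\<close>
  ultimately have "s * s / 2 + s * (s * (s * s)) / 4 \<le> s * (s * 2)"
    unfolding mult.assoc by linarith
  with s assms(2) show ?thesis
    by (simp add: longest_edge_def dist_le_iff_inner pt_coordinates inner_vec_def sum_3 sqrt_numeral_mult_self algebra_simps power2_eq_square)
qed

section \<open>The two bisection steps\<close>

lemma tet_O_in_children: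
  assumes "a > 0"
  shows "tet_O a \<in> bisection_children (tet_E a)"
proof -
  have "tetrahedron_on (pt_A a) (pt_D a) pt_B (pt_C a) (tet_E a)"
    by (rule tetrahedron_on_permute[OF tetrahedron_on_tet_E[OF assms]]) auto
  moreover have "tet_O a = convex hull {midpoint (pt_A a) (pt_D a), pt_D a, pt_B, pt_C a}"
    by (simp add: tet_O_def pt_M_def insert_commute)
  ultimately show ?thesis
    unfolding bisection_children_def using longest_edge_tet_E[OF assms] by blast
qed

text \<open>Both bases are isosceles triangles with one side sqrt(a/2) and two sides sqrt(a), and
  both apexes lie at height a/2 above corresponding base vertices. The motion sends A, B, C, D of
  the smaller tetrahedron to M, N, B, C.\<close>

lemma congruent_tet_E_child:
  assumes "a > 0"
  shows "congruent_sets (tet_E (a / 2)) (convex hull {pt_B, midpoint pt_B (pt_D a), pt_M a, pt_C a})"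
proof -
  define t where "t = sqrt (a / 2)"
  have t: "t > 0" "a / 2 = t * t" and "a = 2 * (t * t)"
    using assms by (auto simp: t_def)
  \<comment> \<open>Now \<open>pt_coordinates\<close> applies to both sizes, with parameter
    \<open>t\<close> for \<open>a / 2\<close> and \<open>sqrt 2 * t\<close> for
    \<open>a\<close>.\<close>
  then have a: "a = (sqrt 2 * t) * (sqrt 2 * t)"
    by simp
  \<comment> \<open>The rotation about the vertical axis that takes \<open>C - B\<close> of the smaller tetrahedron to \<open>B - N\<close>.\<close>
  define L :: "real^3 \<Rightarrow> real^3" where
    "L = (\<lambda>x. vector [sqrt 2 / 4 * (sqrt 7 * x $ 2 - x $ 1), - sqrt 2 / 4 * (sqrt 7 * x $ 1 + x $ 2), x $ 3])"
  have lin: "linear L"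
    by (rule linearI) (simp_all add: L_def vec_eq_iff forall_3 field_simps)
  have nrm: "norm (L x) = norm x" for x
  proof -
    have "L x \<bullet> L x = x \<bullet> x"
      by (simp add: L_def inner_vec_def sum_3 sqrt_numeral_mult_self algebra_simps)
    then show ?thesis by (simp add: norm_eq)
  qed
  define N where "N = midpoint pt_B (pt_D a)"
  define f where "f = (\<lambda>x. N + L x)"
  have "dist (f x) (f y) = dist x y" for x y
    using nrm[of "x - y"] by (simp add: f_def dist_norm linear_diff[OF lin])
  moreover have "f ` tet_E (a / 2) = convex hull {pt_B, N, pt_M a, pt_C a}"
  proof -
    have pts_a: "pt_C a = vector [sqrt 2 * t, 0, 0]"
      "pt_M a = vector [sqrt 2 * t / 4, sqrt 7 * (sqrt 2 * t) / 4, t * t]"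
      "N = vector [sqrt 2 * t / 4, sqrt 7 * (sqrt 2 * t) / 4, 0]"
      using t(1) by (simp_all add: N_def a pt_coordinates vec_eq_iff forall_3 midpoint_component)
    have "f (pt_A (a / 2)) = pt_M a" "f pt_B = N" "f (pt_C (a / 2)) = pt_B" "f (pt_D (a / 2)) = pt_C a"
      unfolding t(2) f_def L_def pts_a pt_coordinates[OF t(1)]
      by (simp_all add: vec_eq_iff forall_3 sqrt_numeral_mult_self algebra_simps)
    then have "f ` {pt_A (a / 2), pt_B, pt_C (a / 2), pt_D (a / 2)} = {pt_B, N, pt_M a, pt_C a}"
      by auto
    moreover have "f ` (convex hull S) = convex hull (f ` S)" for S
    proof -
      have "f ` X = (\<lambda>x. N + x) ` (L ` X)" for X
        by (simp add: f_def image_image)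
      then show ?thesis
        by (simp add: convex_hull_linear_image[OF lin] convex_hull_translation)
    qed
    ultimately show ?thesis
      by (simp add: tet_E_def)
  qed
  ultimately show ?thesis
    unfolding congruent_sets_def N_def by blast
qed

section \<open>The volume ratio of E(a)\<close>

lemma diameter_tet_E:
  assumes "a > 0"
  shows "diameter (tet_E a) = sqrt a * sqrt (2 + a)"
proof -
  have L: "longest_edge (pt_A a) (pt_D a) pt_B (pt_C a)"
    by (rule longest_edge_tet_E[OF assms])
  have "diameter (tet_E a) = dist (pt_A a) (pt_D a)"
    unfolding tet_E_def
    by (rule diameter_convex_hull_eq_dist)
      (use L in \<open>auto simp: longest_edge_def dist_commute order_trans[OF zero_le_dist]\<close>)
  also have "\<dots> = sqrt (a * (2 + a))"
  proof -
    obtain s where "s > 0" "a = s * s"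
      using assms by (rule pos_square)
    then show ?thesis
      unfolding dist_norm norm_eq_sqrt_inner
      by (simp add: pt_coordinates inner_vec_def sum_3 sqrt_numeral_mult_self algebra_simps)
  qed
  finally show ?thesis by (simp add: real_sqrt_mult)
qed

lemma measure_tet_E:
  assumes "a > 0"
  shows "measure lebesgue (tet_E a) = sqrt 7 / 12 * a\<^sup>2"
proof -
  obtain s where s: "s > 0" "a = s * s"
    using assms by (rule pos_square)
  have "distinct [pt_A a, pt_B, pt_C a, pt_D a]"
    using tetrahedron_on_tet_E[OF assms] by (simp add: tetrahedron_on_def)
  then have "measure lebesgue (tet_E a) =
      \<bar>(pt_B - pt_A a) \<bullet> cross3 (pt_C a - pt_A a) (pt_D a - pt_A a)\<bar> / 6"
    unfolding tet_E_def by (rule measure_tetrahedron)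
  also have "(pt_B - pt_A a) \<bullet> cross3 (pt_C a - pt_A a) (pt_D a - pt_A a) = - (sqrt 7 / 2 * a\<^sup>2)"
    using s by (simp add: pt_coordinates cross3_simps power2_eq_square)
  finally show ?thesis by (simp add: abs_mult)
qed

lemma shape_ratio_tet_E:
  assumes "a > 0"
  shows "measure lebesgue (tet_E a) / diameter (tet_E a) ^ 3 = sqrt 7 / 12 * (sqrt a / (2 + a) powr (3 / 2))"
proof -
  have "(2 + a) powr (3 / 2) = ((2 + a) powr (1 / 2)) ^ 3"
    using assms by (simp add: powr_power)
  also have "\<dots> = sqrt (2 + a) ^ 3"
    using assms by (simp add: powr_half_sqrt)
  finally have p: "(2 + a) powr (3 / 2) = sqrt (2 + a) ^ 3" .
  \<comment> \<open>The factor \<open>sqrt a ^ 3\<close> cancels against the cubed diameter, leaving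
    the single \<open>sqrt a\<close> that drives the ratio to zero.\<close>
  have "a\<^sup>2 = sqrt a * sqrt a ^ 3"
    using assms by (simp add: power2_eq_square power3_eq_cube)
  then show ?thesis
    using assms unfolding p by (simp add: measure_tet_E diameter_tet_E power_mult_distrib field_simps)
qed

section \<open>The dihedral angles at CD and MC\<close>

lemma cos_dihedral_angle:
  assumes "u = Q - P" "v = R - P" "w = S - P" "u \<noteq> 0"
  shows "cos (dihedral_angle P Q R S) =
    ((u \<bullet> u) * (v \<bullet> w) - (v \<bullet> u) * (w \<bullet> u)) /
     (sqrt ((u \<bullet> u) * (v \<bullet> v) - (v \<bullet> u)\<^sup>2) * sqrt ((u \<bullet> u) * (w \<bullet> w) - (w \<bullet> u)\<^sup>2))"
proof -
  define d where "d = u \<bullet> u"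
  have d: "d > 0" using assms by (simp add: d_def)
  \<comment> \<open>Products of projections are Gram minors over \<open>d\<close>; the factor 1/d
    cancels between the numerator and the two square roots.\<close>
  have i: "perp_proj u x \<bullet> perp_proj u y = (d * (x \<bullet> y) - (x \<bullet> u) * (y \<bullet> u)) / d" for x y
    using d inner_perp_proj[OF \<open>u \<noteq> 0\<close>, of x y] by (simp add: d_def field_simps)
  show ?thesis
    using d
    by (simp add: dihedral_angle_def cos_vector_angle norm_eq_sqrt_inner i real_sqrt_divide
        power2_eq_square flip: assms(1-3) d_def)
qed

lemma dihedral_angle_bounds: "0 \<le> dihedral_angle P Q R S" "dihedral_angle P Q R S \<le> pi"
proof -
  have "-1 \<le> u \<bullet> v / (norm u * norm v)" "u \<bullet> v / (norm u * norm v) \<le> 1" for u v :: "real^3"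
    unfolding cos_vector_angle[symmetric] by simp_all
  then show "0 \<le> dihedral_angle P Q R S" "dihedral_angle P Q R S \<le> pi"
    unfolding dihedral_angle_def vector_angle_def
    by (auto intro!: arccos_lbound arccos_ubound)
qed

text \<open>Removes the square common to the Gram minors: \<open>c = a / 2\<close> for the angle at
  CD and \<open>c = a / 4\<close> for the one at MC.\<close>

lemma cancel_square_sqrt:
  fixes c x y z :: real
  assumes "c > 0"
  shows "c\<^sup>2 * x / (sqrt (c\<^sup>2 * y) * sqrt (c\<^sup>2 * z)) = x / sqrt (y * z)"
proof -
  have "sqrt (c\<^sup>2 * y) * sqrt (c\<^sup>2 * z) = c\<^sup>2 * sqrt (y * z)"
    using assms by (simp add: real_sqrt_mult power2_eq_square)
  then show ?thesis
    using assms by simp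
qed

text \<open>Geometrically, A lies at height a above B, and B has distance sqrt(7a/8) from CD, so the
  tangent is sqrt(8a/7). The proof compares cosines instead.\<close>

lemma delta_eq:
  assumes "a > 0"
  shows "delta a = arctan (sqrt (8 * a / 7))"
proof -
  obtain s where s: "s > 0" "a = s * s"
    using assms(1) by (rule pos_square)
  define u v w where uvw: "u = pt_D a - pt_C a" "v = pt_A a - pt_C a" "w = pt_B - pt_C a"
  have i: "u \<bullet> u = 2 * a" "v \<bullet> v = a + a\<^sup>2" "w \<bullet> w = a" "v \<bullet> w = a" "v \<bullet> u = a / 2" "w \<bullet> u = a / 2"
    using s by (simp_all add: uvw pt_coordinates inner_vec_def sum_3 sqrt_numeral_mult_self power2_eq_square algebra_simps)
  then have "u \<noteq> 0" using assms by auto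
  have g: "2 * a * a - a / 2 * (a / 2) = (a / 2)\<^sup>2 * 7"
    "2 * a * (a + a\<^sup>2) - (a / 2)\<^sup>2 = (a / 2)\<^sup>2 * (7 * (1 + 8 * a / 7))"
    "2 * a * a - (a / 2)\<^sup>2 = (a / 2)\<^sup>2 * 7"
    by (simp_all add: power2_eq_square field_simps)
  have "cos (delta a) = 7 / sqrt (7\<^sup>2 * (1 + 8 * a / 7))"
    unfolding delta_def cos_dihedral_angle[OF uvw \<open>u \<noteq> 0\<close>] i g
    using assms by (subst cancel_square_sqrt) (simp_all add: power2_eq_square mult_ac)
  also have "\<dots> = 1 / sqrt (1 + 8 * a / 7)"
    unfolding real_sqrt_mult by simp
  also have "\<dots> = cos (arctan (sqrt (8 * a / 7)))"
    using assms by (simp add: cos_arctan)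
  finally have "cos (delta a) = cos (arctan (sqrt (8 * a / 7)))" .
  \<comment> \<open>Cosine is injective on [0, pi], so with both angles in that range equal cosines
    give equal angles.\<close>
  moreover have "0 \<le> arctan (sqrt (8 * a / 7))" "arctan (sqrt (8 * a / 7)) \<le> pi"
    using assms arctan_ubound[of "sqrt (8 * a / 7)"] pi_gt_zero
    by (simp_all add: zero_le_arctan_iff del: pi_gt_zero)
  ultimately show ?thesis
    using dihedral_angle_bounds unfolding delta_def by (metis cos_inj_pi)
qed

text \<open>M lies above the midpoint of BD. As the height becomes small relative to the base, the
  faces MCB and MCD open towards a straight angle; accordingly the formula takes the value -1 at a =
  0.\<close>

lemma cos_Theta:
  assumes "a > 0"
  shows "cos (Theta a) = (2 * a - 7) / sqrt ((4 * a + 7) * (8 * a + 7))"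
proof -
  obtain s where s: "s > 0" "a = s * s"
    using assms(1) by (rule pos_square)
  define u v w where uvw: "u = pt_C a - pt_M a" "v = pt_B - pt_M a" "w = pt_D a - pt_M a"
  have i: "u \<bullet> u = a + a\<^sup>2 / 4" "v \<bullet> v = a / 2 + a\<^sup>2 / 4" "w \<bullet> w = a / 2 + a\<^sup>2 / 4"
     "v \<bullet> w = a\<^sup>2 / 4 - a / 2" "v \<bullet> u = a\<^sup>2 / 4 + a / 4" "w \<bullet> u = a\<^sup>2 / 4 - a / 4"
    using s by (simp_all add: uvw pt_coordinates inner_vec_def sum_3 sqrt_numeral_mult_self power2_eq_square algebra_simps)
  have "u \<bullet> u > 0" using i assms by (auto intro!: add_pos_pos)
  then have "u \<noteq> 0" by auto
  have g: "(a + a\<^sup>2 / 4) * (a\<^sup>2 / 4 - a / 2) - (a\<^sup>2 / 4 + a / 4) * (a\<^sup>2 / 4 - a / 4) = (a / 4)\<^sup>2 * (2 * a - 7)"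
    "(a + a\<^sup>2 / 4) * (a / 2 + a\<^sup>2 / 4) - (a\<^sup>2 / 4 + a / 4)\<^sup>2 = (a / 4)\<^sup>2 * (4 * a + 7)"
    "(a + a\<^sup>2 / 4) * (a / 2 + a\<^sup>2 / 4) - (a\<^sup>2 / 4 - a / 4)\<^sup>2 = (a / 4)\<^sup>2 * (8 * a + 7)"
    by (simp_all add: power2_eq_square field_simps)
  show ?thesis
    unfolding Theta_def cos_dihedral_angle[OF uvw \<open>u \<noteq> 0\<close>] i g
    using assms by (subst cancel_square_sqrt) simp_all
qed

section \<open>Admissibility, limits and failure of the three conditions\<close>

theorem theorem3p1:
  fixes a :: "nat \<Rightarrow> real" and \<T> :: "nat \<Rightarrow> (real^3) set" and \<F> :: "(real^3) set set"
  assumes a: "\<And>k. a k = 1 / 2 ^ k"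
    and T_even: "\<And>k. \<T> (2 * k) = tet_E (a k)"
    and T_odd: "\<And>k. \<T> (2 * k + 1) = tet_O (a k)"
    and F: "\<F> = range (\<lambda>k. tet_E (a k)) \<union> range (\<lambda>k. tet_O (a k))"
  shows "admissible_bisection_sequence \<T> \<and>
    \<not> shape_regular \<F> \<and>
    \<not> minimum_angle_condition \<F> \<and>
    \<not> maximum_angle_condition \<F> \<and>
    (\<forall>k. measure lebesgue (tet_E (a k)) / diameter (tet_E (a k)) ^ 3
           = sqrt 7 / 12 * (sqrt (a k) / (2 + a k) powr (3 / 2)) \<and>
         delta (a k) = arctan (sqrt (8 * a k / 7)) \<and>
         cos (Theta (a k)) = (2 * a k - 7) / sqrt ((4 * a k + 7) * (8 * a k + 7))) \<and>
    (\<lambda>k. measure lebesgue (tet_E (a k)) / diameter (tet_E (a k)) ^ 3) \<longlonglongrightarrow> 0 \<and>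
    (\<lambda>k. delta (a k)) \<longlonglongrightarrow> 0 \<and>
    (\<lambda>k. cos (Theta (a k))) \<longlonglongrightarrow> -1 \<and>
    (\<lambda>k. Theta (a k)) \<longlonglongrightarrow> pi"
proof -
  have pos: "a k > 0" and le1: "a k \<le> 1" and half: "a (Suc k) = a k / 2" for k
    by (simp_all add: a)
  have a0: "a \<longlonglongrightarrow> 0"
    using LIMSEQ_divide_realpow_zero[of 2 1] by (simp add: a[abs_def])
  have adm: "admissible_bisection_sequence \<T>"
    unfolding admissible_bisection_sequence_def
  proof (intro conjI allI)
    fix n :: nat
    have par: "(\<exists>k. n = 2 * k) \<or> (\<exists>k. n = 2 * k + 1)" by presburger
    then show "tetrahedron (\<T> n)"
      unfolding tetrahedron_def
      using T_even T_odd tetrahedron_on_tet_E[OF pos] tetrahedron_on_tet_O[OF pos] by metis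
    from par show "\<exists>T'\<in>bisection_children (\<T> n). congruent_sets (\<T> (Suc n)) T'"
    proof (elim disjE exE)
      fix k assume n: "n = 2 * k"
      have "congruent_sets (tet_O (a k)) (tet_O (a k))"
        unfolding congruent_sets_def by (rule exI[of _ id]) simp
      then show ?thesis
        using tet_O_in_children[OF pos, of k] n T_even[of k] T_odd[of k] by auto
    next
      fix k assume n: "n = 2 * k + 1"
      have "tetrahedron_on pt_B (pt_D (a k)) (pt_M (a k)) (pt_C (a k)) (tet_O (a k))"
        by (rule tetrahedron_on_permute[OF tetrahedron_on_tet_O[OF pos]]) auto
      then have "convex hull {pt_B, midpoint pt_B (pt_D (a k)), pt_M (a k), pt_C (a k)}
          \<in> bisection_children (tet_O (a k))"
        unfolding bisection_children_def using longest_edge_tet_O[OF pos le1] by blast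
      \<comment> \<open>Here \<open>Suc n = 2 * Suc k\<close>, so the successor of an odd member is
        the next E with halved parameter.\<close>
      moreover have "\<T> (Suc n) = tet_E (a k / 2)"
        using n T_even[of "Suc k"] by (simp add: half)
      ultimately show ?thesis
        using congruent_tet_E_child[OF pos, of k] n T_odd[of k] by auto
    qed
  qed
  have lim_ratio: "(\<lambda>k. measure lebesgue (tet_E (a k)) / diameter (tet_E (a k)) ^ 3) \<longlonglongrightarrow> 0"
    unfolding shape_ratio_tet_E[OF pos] by (rule tendsto_eq_intros a0 refl | simp)+
  have lim_delta: "(\<lambda>k. delta (a k)) \<longlonglongrightarrow> 0"
    unfolding delta_eq[OF pos] by (rule tendsto_eq_intros a0 refl | simp)+
  have lim_cos: "(\<lambda>k. cos (Theta (a k))) \<longlonglongrightarrow> -1"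
    unfolding cos_Theta[OF pos] by (rule tendsto_eq_intros a0 refl | simp)+
  \<comment> \<open>\<open>arccos\<close> is continuous up to the endpoint -1, and it inverts
    \<open>cos\<close> on [0, pi], where \<open>Theta\<close> takes its values.\<close>
  have "(\<lambda>k. arccos (cos (Theta (a k)))) \<longlonglongrightarrow> arccos (-1)"
    by (rule continuous_on_tendsto_compose[OF continuous_on_arccos' lim_cos]) auto
  then have lim_Theta: "(\<lambda>k. Theta (a k)) \<longlonglongrightarrow> pi"
    by (simp add: arccos_cos dihedral_angle_bounds Theta_def)
  have "\<not> shape_regular \<F>"
  proof
    assume "shape_regular \<F>"
    then obtain c where c: "c > 0" "\<And>T. T \<in> \<F> \<Longrightarrow> measure lebesgue T \<ge> c * diameter T ^ 3"
      unfolding shape_regular_def by blast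
    \<comment> \<open>The E members alone refute shape regularity: a uniform lower bound on their
      ratios would survive in the limit 0.\<close>
    have "c \<le> measure lebesgue (tet_E (a k)) / diameter (tet_E (a k)) ^ 3" for k
    proof -
      have "diameter (tet_E (a k)) ^ 3 > 0"
        unfolding diameter_tet_E[OF pos] using pos[of k] by simp
      then show ?thesis
        using c(2)[of "tet_E (a k)"] by (simp add: F pos_le_divide_eq)
    qed
    then have "c \<le> 0"
      by (intro LIMSEQ_le_const[OF lim_ratio]) auto
    with c(1) show False by simp
  qed
  moreover have "\<not> minimum_angle_condition \<F>"
  proof
    assume "minimum_angle_condition \<F>"
    then obtain c where c: "c > 0" "\<And>T \<alpha>. T \<in> \<F> \<Longrightarrow> \<alpha> \<in> dihedral_angles T \<Longrightarrow> c \<le> \<alpha>"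
      unfolding minimum_angle_condition_def by blast
    have "c \<le> delta (a k)" for k
    proof (rule c(2))
      show "tet_E (a k) \<in> \<F>" by (simp add: F)
      have "tetrahedron_on (pt_C (a k)) (pt_D (a k)) (pt_A (a k)) pt_B (tet_E (a k))"
        by (rule tetrahedron_on_permute[OF tetrahedron_on_tet_E[OF pos]]) auto
      then show "delta (a k) \<in> dihedral_angles (tet_E (a k))"
        unfolding dihedral_angles_def delta_def by blast
    qed
    then have "c \<le> 0"
      by (intro LIMSEQ_le_const[OF lim_delta]) auto
    with c(1) show False by simp
  qed
  moreover have "\<not> maximum_angle_condition \<F>"
  proof
    assume "maximum_angle_condition \<F>"
    then obtain c where c: "c < pi" "\<And>T \<alpha>. T \<in> \<F> \<Longrightarrow> \<alpha> \<in> dihedral_angles T \<Longrightarrow> \<alpha> \<le> c"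
      unfolding maximum_angle_condition_def by blast
    have "Theta (a k) \<le> c" for k
    proof (rule c(2))
      show "tet_O (a k) \<in> \<F>" by (simp add: F)
      have "tetrahedron_on (pt_M (a k)) (pt_C (a k)) pt_B (pt_D (a k)) (tet_O (a k))"
        by (rule tetrahedron_on_permute[OF tetrahedron_on_tet_O[OF pos]]) auto
      then show "Theta (a k) \<in> dihedral_angles (tet_O (a k))"
        unfolding dihedral_angles_def Theta_def by blast
    qed
    then have "pi \<le> c"
      by (intro LIMSEQ_le_const2[OF lim_Theta]) auto
    with c(1) show False by simp
  qed
  ultimately show ?thesis
    using adm lim_ratio lim_delta lim_cos lim_Theta
      shape_ratio_tet_E[OF pos] delta_eq[OF pos] cos_Theta[OF pos] by blast
qed

end
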